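(* Let $K$ be a finite simplicial complex, let $S$ be a nonempty isolated invariant set under a multivector field $\mathcal{V}$ on $K$, and let $S'$ be an isolated invariant set under $\mathcal{V}'$ that is obtained from $S$ by the persistence step of the Tracking Protocol; that is: $\mathcal{V}'$ is an atomic coarsening of $\mathcal{V}$ whose merged multivector $V$ satisfies $V\cap S\neq\emptyset$ and $V\not\subseteq S$; the set $A:=\langle S\cup V\rangle_{\mathcal{V}'}$ satisfies $\mathrm{Inv}_{\mathcal{V}}(A)\neq S$; $S'=\mathrm{Inv}_{\mathcal{V}'}(A)$; and $S$ and $S'$ are isolated by a common isolating set (a closed set that is an isolating set for $S$ under $\mathcal{V}$ and for $S'$ under $\mathcal{V}'$). If $S''$ is an isolated invariant set under $\mathcal{V}'$ with $S\subseteq S''$, then $S'\subseteq S''$.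
   Context: $K$ is a finite simplicial complex, viewed as the finite set of its (nonempty) simplices; $\leq$ is the face relation. Homology is simplicial homology with coefficients in a fixed finite field. Closure and mouth: $\mathrm{cl}(\sigma) = \{\tau \in K : \tau \leq \sigma\}$, $\mathrm{cl}(A) = \bigcup_{\sigma\in A}\mathrm{cl}(\sigma)$ for $A\subseteq K$; $A$ is closed if $A=\mathrm{cl}(A)$; $\mathrm{mo}(A) = \mathrm{cl}(A)\setminus A$. A set $A\subseteq K$ is convex if $\sigma\leq\rho\leq\tau$ with $\sigma,\tau\in A$, $\rho\in K$ implies $\rho\in A$. A multivector is a convex subset of $K$; a multivector field on $K$ is a partition of $K$ into multivectors. $[\sigma]_{\mathcal{V}}$ is the unique multivector of $\mathcal{V}$ containing $\sigma$. A multivector $V$ is critical if $H(\mathrm{cl}(V),\mathrm{mo}(V))\neq 0$. A set $A\subseteq K$ is $\mathcal{V}$-compatible if it is a union of multivectors of $\mathcal{V}$. Dynamics: $F_{\mathcal{V}}(\sigma)=\mathrm{cl}(\sigma)\cup[\sigma]_{\mathcal{V}}$, and $F_{\mathcal{V}}(A)=\bigcup_{\sigma\in A}F_{\mathcal{V}}(\sigma)$. A path is a map $\rho:\mathbb{Z}\cap[0,n]\to K$ with $\rho(i+1)\in F_{\mathcal{V}}(\rho(i))$ for $0\le i\le n-1$; a solution is a map $\rho:\mathbb{Z}\to K$ with $\rho(i+1)\in F_{\mathcal{V}}(\rho(i))$ for all $i\in\mathbb{Z}$. A solution $\rho$ is essential if for every $i$ with $[\rho(i)]_{\mathcal{V}}$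 not critical there exist $i^-<i<i^+$ with $[\rho(i^-)]_{\mathcal{V}}\neq[\rho(i)]_{\mathcal{V}}\neq[\rho(i^+)]_{\mathcal{V}}$. Invariant sets: $\mathrm{Inv}_{\mathcal{V}}(A)$ is the set of $\sigma\in A$ for which there is an essential solution $\rho:\mathbb{Z}\to A$ (under $\mathcal{V}$) with $\rho(i)=\sigma$ for some $i$. $S$ is an invariant set under $\mathcal{V}$ if $S=\mathrm{Inv}_{\mathcal{V}}(S)$. An invariant set $S$ is an isolated invariant set under $\mathcal{V}$ if there is a closed set $N$ with $F_{\mathcal{V}}(S)\subseteq N$ such that every path $\rho:\mathbb{Z}\cap[0,n]\to N$ with $\rho(0),\rho(n)\in S$ has its whole image in $S$; such an $N$ is an isolating set for $S$ (under $\mathcal{V}$). Atomic coarsening: $\mathcal{V}'$ is an atomic coarsening of $\mathcal{V}$ if each multivector of $\mathcal{V}$ is contained in a multivector of $\mathcal{V}'$, $|\mathcal{V}'\setminus\mathcal{V}|=1$ and $|\mathcal{V}\setminus\mathcal{V}'|=2$. The unique element of $\mathcal{V}'\setminus\mathcal{V}$ is the merged multivector. $\langle S\cup V\rangle_{\mathcal{V}'}$ denotes the intersection of all $\mathcal{V}'$-compatible and convex subsets of $K$ that contain $S\cup V$. *)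

theory Defs
  imports "HOL-Algebra.Elementary_Groups" "HOL-Library.Disjoint_Sets"
begin

section \<open>Finite simplicial complexes\<close>

definition finite_simplicial_complex :: "'a set set \<Rightarrow> bool" where
  "finite_simplicial_complex K \<longleftrightarrow>
     finite K \<and> (\<forall>\<sigma>\<in>K. finite \<sigma> \<and> \<sigma> \<noteq> {}) \<and>
     (\<forall>\<sigma>\<in>K. \<forall>\<tau>. \<tau> \<subseteq> \<sigma> \<and> \<tau> \<noteq> {} \<longrightarrow> \<tau> \<in> K)"

definition cl :: "'a set set \<Rightarrow> 'a set set \<Rightarrow> 'a set set" where
  "cl K A = {\<tau> \<in> K. \<exists>\<sigma>\<in>A. \<tau> \<subseteq> \<sigma>}"

definition closed_in_complex :: "'a set set \<Rightarrow> 'a set set \<Rightarrow> bool" where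
  "closed_in_complex K A \<longleftrightarrow> A \<subseteq> K \<and> A = cl K A"

definition mo :: "'a set set \<Rightarrow> 'a set set \<Rightarrow> 'a set set" where
  "mo K A = cl K A - A"

definition convex_in_complex :: "'a set set \<Rightarrow> 'a set set \<Rightarrow> bool" where
  "convex_in_complex K A \<longleftrightarrow>
     A \<subseteq> K \<and> (\<forall>\<sigma>\<in>A. \<forall>\<tau>\<in>A. \<forall>\<rho>\<in>K. \<sigma> \<subseteq> \<rho> \<and> \<rho> \<subseteq> \<tau> \<longrightarrow> \<rho> \<in> A)"


section \<open>Relative simplicial homology\<close>

text \<open>
  Oriented chains with coefficients in a field, without choosing an order on the vertices: a
  \<open>p\<close>-chain of a complex \<open>L\<close> is a function \<open>c\<close> on the vertex orderings of the \<open>p\<close>-simplices of \<open>L\<close>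
  (lists with \<open>p + 1\<close> distinct entries; \<open>c\<close> vanishes on all other lists) that takes opposite values
  on opposite orientations. Sign change under adjacent transpositions amounts to
  \<open>c (v\<^bsub>\<pi> 0\<^esub>, \<dots>, v\<^bsub>\<pi> p\<^esub>) = sign \<pi> * c (v\<^bsub>0\<^esub>, \<dots>, v\<^bsub>p\<^esub>)\<close> for every permutation \<open>\<pi>\<close>.
\<close>

definition chains :: "nat \<Rightarrow> 'a set set \<Rightarrow> ('a list \<Rightarrow> 'f::field) set" where
  "chains p L = {c.
     (\<forall>xs. c xs \<noteq> 0 \<longrightarrow> length xs = Suc p \<and> distinct xs \<and> set xs \<in> L) \<and>
     (\<forall>xs a b ys. c (xs @ b # a # ys) = - c (xs @ a # b # ys))}"

text \<open>
  The coefficient at \<open>ys\<close> of the usual boundary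
  \<open>\<partial>[v\<^bsub>0\<^esub>, \<dots>, v\<^bsub>p\<^esub>] = \<Sum>\<^bsub>i\<^esub> (-1)\<^bsup>i\<^esup> [v\<^bsub>0\<^esub>, \<dots>, v\<^bsub>i-1\<^esub>, v\<^bsub>i+1\<^esub>, \<dots>, v\<^bsub>p\<^esub>]\<close>: a simplex with the vertices of
  \<open>ys\<close> as a facet has exactly one further vertex \<open>v\<close>, it can be oriented as \<open>[v, ys]\<close>, and \<open>\<partial>[v, ys]\<close> has coefficient \<open>1\<close> at \<open>ys\<close>.
  The value at \<open>[]\<close> is set to \<open>0\<close>, so that \<open>\<partial>\<close> vanishes on \<open>0\<close>-chains (the homology is not reduced).
\<close>

definition boundary :: "('a list \<Rightarrow> 'f::field) \<Rightarrow> 'a list \<Rightarrow> 'f" where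
  "boundary c ys = (if ys = [] then 0 else \<Sum>v | c (v # ys) \<noteq> 0. c (v # ys))"

text \<open>
  \<open>H\<^bsub>p\<^esub>(L, M)\<close> for a subcomplex \<open>M\<close> of \<open>L\<close>, in the style of the singular homology groups
  in HOL-Homology: cycles modulo \<open>M\<close> divided by boundaries modulo \<open>M\<close>.
\<close>

definition relcycles :: "nat \<Rightarrow> 'a set set \<Rightarrow> 'a set set \<Rightarrow> ('a list \<Rightarrow> 'f::field) set" where
  "relcycles p L M = {c \<in> chains p L. boundary c \<in> chains (p - 1) M}"

definition relboundaries :: "nat \<Rightarrow> 'a set set \<Rightarrow> 'a set set \<Rightarrow> ('a list \<Rightarrow> 'f::field) set" where
  "relboundaries p L M =
     {c \<in> chains p L. \<exists>d \<in> chains (Suc p) L. (\<lambda>xs. boundary d xs - c xs) \<in> chains p M}"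

definition relcycle_group :: "nat \<Rightarrow> 'a set set \<Rightarrow> 'a set set \<Rightarrow> ('a list \<Rightarrow> 'f::field) monoid" where
  "relcycle_group p L M =
     \<lparr>carrier = relcycles p L M, mult = (\<lambda>c d xs. c xs + d xs), one = (\<lambda>xs. 0)\<rparr>"

definition relative_homology ::
    "nat \<Rightarrow> 'a set set \<Rightarrow> 'a set set \<Rightarrow> ('a list \<Rightarrow> 'f::field) set monoid" where
  "relative_homology p L M = relcycle_group p L M Mod relboundaries p L M"


subsection \<open>The relative homology groups are well defined\<close>

lemma chains_zero: "(\<lambda>xs. 0) \<in> chains p L"
  by (simp add: chains_def)

lemma chains_swap: "c \<in> chains p L \<Longrightarrow> c (xs @ b # a # ys) = - c (xs @ a # b # ys)"
  unfolding chains_def by blast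

lemma chains_support:
  assumes "c \<in> chains p L" "c xs \<noteq> 0"
  shows "length xs = Suc p" "distinct xs" "set xs \<in> L"
  using assms unfolding chains_def by blast+

lemma chains_diff:
  assumes c: "c \<in> chains p L" and d: "d \<in> chains p L"
  shows "(\<lambda>xs. c xs - d xs) \<in> chains p L"
proof -
  have "length xs = Suc p \<and> distinct xs \<and> set xs \<in> L" if "c xs - d xs \<noteq> 0" for xs
  proof (cases "c xs = 0")
    case True
    with that have "d xs \<noteq> 0" by simp
    then show ?thesis using chains_support[OF d] by simp
  next
    case False
    then show ?thesis using chains_support[OF c] by simp
  qed
  moreover have "c (xs @ b # a # ys) - d (xs @ b # a # ys)
      = - (c (xs @ a # b # ys) - d (xs @ a # b # ys))" for xs a b ys
    by (simp add: chains_swap[OF c, of xs b a ys] chains_swap[OF d, of xs b a ys])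
  ultimately show ?thesis unfolding chains_def by blast
qed

lemma chains_uminus: "c \<in> chains p L \<Longrightarrow> (\<lambda>xs. - c xs) \<in> chains p L"
  using chains_diff[OF chains_zero, of c p L] by simp

lemma chains_add: "c \<in> chains p L \<Longrightarrow> d \<in> chains p L \<Longrightarrow> (\<lambda>xs. c xs + d xs) \<in> chains p L"
  using chains_diff[of c p L "\<lambda>xs. - d xs"] chains_uminus[of d p L] by simp

lemma chains_mono: "M \<subseteq> L \<Longrightarrow> chains p M \<subseteq> chains p L"
  unfolding chains_def by blast

lemma finite_vertices: "finite_simplicial_complex L \<Longrightarrow> finite (\<Union>L)"
  unfolding finite_simplicial_complex_def by (intro finite_Union) blast+

lemma boundary_zero: "boundary (\<lambda>xs. 0) = (\<lambda>xs. 0)"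
  by (rule ext) (simp add: boundary_def)

lemma boundary_eq_sum:
  assumes "finite_simplicial_complex L" "c \<in> chains p L" "ys \<noteq> []"
  shows "boundary c ys = (\<Sum>v\<in>\<Union>L. c (v # ys))"
proof -
  have "v \<in> \<Union>L" if "c (v # ys) \<noteq> 0" for v
    using chains_support(3)[OF assms(2) that] by (intro UnionI[of "set (v # ys)"]) simp_all
  then have "(\<Sum>v | c (v # ys) \<noteq> 0. c (v # ys)) = (\<Sum>v\<in>\<Union>L. c (v # ys))"
    by (intro sum.mono_neutral_left finite_vertices[OF assms(1)]) blast+
  then show ?thesis using assms(3) by (simp add: boundary_def)
qed

lemma boundary_diff:
  assumes "finite_simplicial_complex L" "c \<in> chains p L" "d \<in> chains p L"
  shows "boundary (\<lambda>xs. c xs - d xs) = (\<lambda>xs. boundary c xs - boundary d xs)"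
proof
  fix ys
  show "boundary (\<lambda>xs. c xs - d xs) ys = boundary c ys - boundary d ys"
  proof (cases "ys = []")
    case False
    show ?thesis
      using boundary_eq_sum[OF assms(1) chains_diff[OF assms(2,3)] False]
        boundary_eq_sum[OF assms(1) assms(2) False] boundary_eq_sum[OF assms(1) assms(3) False]
      by (simp add: sum_subtractf)
  qed (simp add: boundary_def)
qed

lemma boundary_zero_chain:
  assumes "c \<in> chains 0 L"
  shows "boundary c = (\<lambda>xs. 0)"
proof
  fix ys
  have "c (v # ys) = 0" if "ys \<noteq> []" for v
    using chains_support(1)[OF assms, of "v # ys"] that by (cases "c (v # ys) = 0") auto
  then show "boundary c ys = 0" by (simp add: boundary_def)
qed

lemma face_in_complex:
  assumes "finite_simplicial_complex L" "\<sigma> \<in> L" "\<tau> \<subseteq> \<sigma>" "\<tau> \<noteq> {}"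
  shows "\<tau> \<in> L"
  using assms unfolding finite_simplicial_complex_def by meson

lemma boundary_in_chains:
  assumes "finite_simplicial_complex L" "c \<in> chains (Suc p) L"
  shows "boundary c \<in> chains p L"
proof -
  have swap: "c (v # xs @ b # a # ys) = - c (v # xs @ a # b # ys)" for v xs a b ys
    by (rule chains_swap[OF assms(2), of "v # xs", unfolded append_Cons])
  have "boundary c (xs @ b # a # ys) = - boundary c (xs @ a # b # ys)" for xs a b ys
  proof -
    have "boundary c (xs @ b # a # ys) = (\<Sum>v\<in>\<Union>L. c (v # xs @ b # a # ys))"
      by (rule boundary_eq_sum[OF assms]) simp
    also have "\<dots> = (\<Sum>v\<in>\<Union>L. - c (v # xs @ a # b # ys))"
      by (intro sum.cong refl swap)
    also have "\<dots> = - boundary c (xs @ a # b # ys)"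
      unfolding sum_negf by (subst boundary_eq_sum[OF assms]) simp_all
    finally show ?thesis .
  qed
  moreover have "length ys = Suc p \<and> distinct ys \<and> set ys \<in> L" if ne: "boundary c ys \<noteq> 0" for ys
  proof -
    have ys: "ys \<noteq> []" using ne by (auto simp: boundary_def)
    have "(\<Sum>v\<in>\<Union>L. c (v # ys)) \<noteq> 0" using ne boundary_eq_sum[OF assms ys] by simp
    then obtain v where "c (v # ys) \<noteq> 0" by (rule sum.not_neutral_contains_not_neutral)
    then have *: "length (v # ys) = Suc (Suc p)" "distinct (v # ys)" "set (v # ys) \<in> L"
      using chains_support[OF assms(2)] by blast+
    have "set ys \<in> L" by (rule face_in_complex[OF assms(1) *(3)]) (use ys in auto)
    then show ?thesis using * by simp
  qed
  ultimately show ?thesis unfolding chains_def by blast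
qed

lemma boundary_boundary:
  assumes L: "finite_simplicial_complex L" and c: "c \<in> chains (Suc p) L"
  shows "boundary (boundary c) = (\<lambda>xs. 0)"
proof
  fix ys
  define A where "A = \<Union>L"
  show "boundary (boundary c) ys = 0"
  proof (cases "ys = []")
    case False
    have fin: "finite A" using finite_vertices[OF L] by (simp add: A_def)
    have swap: "c (v # w # ys) = - c (w # v # ys)" for v w
      by (rule chains_swap[OF c, of "[]", unfolded append_Nil])
    have diag: "c (v # v # ys) = 0" for v
      using chains_support(2)[OF c, of "v # v # ys"] by auto
    have *: "(\<Sum>v\<in>B. \<Sum>w\<in>B. c (w # v # ys)) = 0" if "finite B" for B
      using that
    proof (induction B)
      case (insert x B)
      have "(\<Sum>v\<in>insert x B. \<Sum>w\<in>insert x B. c (w # v # ys))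
        = (\<Sum>w\<in>B. c (w # x # ys)) + (\<Sum>v\<in>B. c (x # v # ys))"
        using insert by (simp add: diag sum.distrib)
      also have "(\<Sum>v\<in>B. c (x # v # ys)) = - (\<Sum>w\<in>B. c (w # x # ys))"
        unfolding sum_negf[symmetric] by (intro sum.cong refl swap)
      finally show ?case by simp
    qed simp
    have "boundary (boundary c) ys = (\<Sum>v\<in>A. boundary c (v # ys))"
      unfolding A_def by (rule boundary_eq_sum[OF L boundary_in_chains[OF L c] False])
    also have "\<dots> = (\<Sum>v\<in>A. \<Sum>w\<in>A. c (w # v # ys))"
      unfolding A_def by (intro sum.cong refl boundary_eq_sum[OF L c]) simp
    finally show ?thesis using *[OF fin] by simp
  qed (simp add: boundary_def)
qed

lemma subcomplex_boundary:
  assumes "finite_simplicial_complex M" "c \<in> chains p M"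
  shows "boundary c \<in> chains (p - 1) M"
  using assms boundary_in_chains[of M c "p - 1"] boundary_zero_chain[of c M]
  by (cases p) (auto simp: chains_zero)

lemma relcycles_diff:
  assumes "finite_simplicial_complex L" "c \<in> relcycles p L M" "d \<in> relcycles p L M"
  shows "(\<lambda>xs. c xs - d xs) \<in> relcycles p L M"
  using assms by (auto simp: relcycles_def chains_diff boundary_diff)

lemma relcycles_zero: "(\<lambda>xs. 0) \<in> relcycles p L M"
  by (simp add: relcycles_def boundary_zero chains_zero)

lemma relcycles_uminus:
  assumes "finite_simplicial_complex L" "c \<in> relcycles p L M"
  shows "(\<lambda>xs. - c xs) \<in> relcycles p L M"
  using relcycles_diff[OF assms(1) relcycles_zero assms(2)] by simp

lemma relcycles_add:
  assumes "finite_simplicial_complex L" "c \<in> relcycles p L M" "d \<in> relcycles p L M"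
  shows "(\<lambda>xs. c xs + d xs) \<in> relcycles p L M"
  using relcycles_diff[OF assms(1,2) relcycles_uminus[OF assms(1,3)]] by simp

lemma relcycle_group_comm_group:
  assumes "finite_simplicial_complex L"
  shows "comm_group (relcycle_group p L M)"
proof (rule comm_groupI)
  fix c assume "c \<in> carrier (relcycle_group p L M)"
  then show "\<exists>d\<in>carrier (relcycle_group p L M).
      d \<otimes>\<^bsub>relcycle_group p L M\<^esub> c = \<one>\<^bsub>relcycle_group p L M\<^esub>"
    using relcycles_uminus[OF assms] by (intro bexI[of _ "\<lambda>xs. - c xs"]) (auto simp: relcycle_group_def)
qed (auto simp: relcycle_group_def relcycles_zero relcycles_add[OF assms] algebra_simps)

lemma relboundaries_subset_relcycles:
  assumes L: "finite_simplicial_complex L" and M: "finite_simplicial_complex M" and "M \<subseteq> L"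
  shows "relboundaries p L M \<subseteq> relcycles p L M"
proof
  fix c assume "c \<in> relboundaries p L M"
  then obtain d where c: "c \<in> chains p L" and d: "d \<in> chains (Suc p) L"
    and e: "(\<lambda>xs. boundary d xs - c xs) \<in> chains p M" by (auto simp: relboundaries_def)
  have "boundary (\<lambda>xs. boundary d xs - c xs) = (\<lambda>xs. - boundary c xs)"
    using boundary_diff[OF L boundary_in_chains[OF L d] c] boundary_boundary[OF L d] by simp
  with subcomplex_boundary[OF M e] have "(\<lambda>xs. - boundary c xs) \<in> chains (p - 1) M" by simp
  then show "c \<in> relcycles p L M"
    using chains_uminus[of "\<lambda>xs. - boundary c xs" "p - 1" M] c by (simp add: relcycles_def)
qed

lemma relboundaries_diff:
  assumes L: "finite_simplicial_complex L"
    and "c \<in> relboundaries p L M" "c' \<in> relboundaries p L M"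
  shows "(\<lambda>xs. c xs - c' xs) \<in> relboundaries p L M"
proof -
  obtain d d' where c: "c \<in> chains p L" "d \<in> chains (Suc p) L"
      "(\<lambda>xs. boundary d xs - c xs) \<in> chains p M"
    and c': "c' \<in> chains p L" "d' \<in> chains (Suc p) L"
      "(\<lambda>xs. boundary d' xs - c' xs) \<in> chains p M"
    using assms(2,3) by (auto simp: relboundaries_def)
  have "(\<lambda>xs. boundary (\<lambda>xs. d xs - d' xs) xs - (c xs - c' xs))
      = (\<lambda>xs. (boundary d xs - c xs) - (boundary d' xs - c' xs))"
    by (simp add: boundary_diff[OF L c(2) c'(2)] algebra_simps)
  then have "(\<lambda>xs. boundary (\<lambda>xs. d xs - d' xs) xs - (c xs - c' xs)) \<in> chains p M"
    using chains_diff[OF c(3) c'(3)] by simp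
  then show ?thesis
    using chains_diff[OF c(1) c'(1)] chains_diff[OF c(2) c'(2)]
    unfolding relboundaries_def by blast
qed

lemma relative_homology_group:
  assumes L: "finite_simplicial_complex L" and M: "finite_simplicial_complex M" and "M \<subseteq> L"
  shows "group (relative_homology p L M :: ('a list \<Rightarrow> 'f::field) set monoid)"
proof -
  let ?G = "relcycle_group p L M :: ('a list \<Rightarrow> 'f) monoid"
  let ?B = "relboundaries p L M :: ('a list \<Rightarrow> 'f) set"
  interpret comm_group ?G by (rule relcycle_group_comm_group[OF L])
  have inv: "inv\<^bsub>?G\<^esub> c = (\<lambda>xs. - c xs)" if "c \<in> relcycles p L M" for c :: "'a list \<Rightarrow> 'f"
    using that relcycles_uminus[OF L that] by (intro inv_equality) (auto simp: relcycle_group_def)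
  have zero: "(\<lambda>xs. 0) \<in> ?B"
    unfolding relboundaries_def
    by (intro CollectI conjI bexI[of _ "\<lambda>xs. 0"]) (simp_all add: boundary_zero chains_zero)
  have uminus: "(\<lambda>xs. - c xs) \<in> ?B" if "c \<in> ?B" for c
    using relboundaries_diff[OF L zero that] by simp
  have "subgroup ?B ?G"
  proof (rule subgroupI)
    show "?B \<subseteq> carrier ?G"
      using relboundaries_subset_relcycles[OF assms] by (simp add: relcycle_group_def)
    show "?B \<noteq> {}" using zero by blast
    show "inv\<^bsub>?G\<^esub> c \<in> ?B" if "c \<in> ?B" for c
      using inv[of c] uminus[OF that] subsetD[OF relboundaries_subset_relcycles[OF assms] that] by simp
    show "c \<otimes>\<^bsub>?G\<^esub> d \<in> ?B" if "c \<in> ?B" "d \<in> ?B" for c d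
      using relboundaries_diff[OF L that(1) uminus[OF that(2)]] by (simp add: relcycle_group_def)
  qed
  then show ?thesis
    unfolding relative_homology_def by (intro normal.factorgroup_is_group subgroup_imp_normal)
qed

lemma cl_complex:
  assumes "finite_simplicial_complex K"
  shows "finite_simplicial_complex (cl K A)"
  unfolding finite_simplicial_complex_def
proof (intro conjI ballI allI impI)
  show "finite (cl K A)"
    using assms unfolding finite_simplicial_complex_def cl_def by simp
  fix \<sigma> assume s: "\<sigma> \<in> cl K A"
  show "finite \<sigma>" "\<sigma> \<noteq> {}"
    using assms s unfolding finite_simplicial_complex_def cl_def by blast+
  show "\<tau> \<in> cl K A" if "\<tau> \<subseteq> \<sigma> \<and> \<tau> \<noteq> {}" for \<tau>
    using face_in_complex[OF assms, of \<sigma> \<tau>] s that unfolding cl_def by blast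
qed

lemma mo_complex:
  assumes K: "finite_simplicial_complex K" and V: "convex_in_complex K V"
  shows "finite_simplicial_complex (mo K V)"
proof -
  have "\<tau> \<in> mo K V" if t: "\<tau> \<in> K" "\<tau> \<subseteq> \<rho>" "\<rho> \<in> mo K V" for \<tau> \<rho>
  proof -
    obtain \<sigma> where \<rho>: "\<rho> \<in> K" "\<rho> \<notin> V" and \<sigma>: "\<sigma> \<in> V" "\<rho> \<subseteq> \<sigma>"
      using t(3) unfolding mo_def cl_def by blast
    have "\<tau> \<notin> V" using V t(2) \<rho> \<sigma> unfolding convex_in_complex_def by meson
    moreover have "\<tau> \<in> cl K V"
      using t(1) \<sigma>(1) subset_trans[OF t(2) \<sigma>(2)] unfolding cl_def by blast
    ultimately show ?thesis unfolding mo_def by simp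
  qed
  moreover have "mo K V \<subseteq> K" unfolding mo_def cl_def by blast
  ultimately have "cl K (mo K V) = mo K V" unfolding cl_def[of K "mo K V"] by blast
  then show ?thesis using cl_complex[OF K, of "mo K V"] by simp
qed

lemma multivector_homology_group:
  assumes "finite_simplicial_complex K" "convex_in_complex K V"
  shows "group (relative_homology p (cl K V) (mo K V))"
  by (rule relative_homology_group[OF cl_complex[OF assms(1)] mo_complex[OF assms]])
    (simp add: mo_def)


section \<open>Multivector fields\<close>

definition multivector_field :: "'a set set \<Rightarrow> 'a set set set \<Rightarrow> bool" where
  "multivector_field K \<V> \<longleftrightarrow> partition_on K \<V> \<and> (\<forall>V\<in>\<V>. convex_in_complex K V)"

definition multivector_of :: "'a set set set \<Rightarrow> 'a set \<Rightarrow> 'a set set" where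
  "multivector_of \<V> \<sigma> = (THE V. V \<in> \<V> \<and> \<sigma> \<in> V)"

text \<open>The parameter \<open>\<F>\<close> carries only its type \<open>'f\<close>, the coefficient field.\<close>

definition critical :: "'f::{field,finite} itself \<Rightarrow> 'a set set \<Rightarrow> 'a set set \<Rightarrow> bool" where
  "critical \<F> K V \<longleftrightarrow>
     (\<exists>p. \<not> trivial_group (relative_homology p (cl K V) (mo K V) :: ('a list \<Rightarrow> 'f) set monoid))"

definition compatible :: "'a set set set \<Rightarrow> 'a set set \<Rightarrow> bool" where
  "compatible \<V> A \<longleftrightarrow> (\<exists>\<W>\<subseteq>\<V>. A = \<Union>\<W>)"

definition compatible_convex_hull ::
    "'a set set \<Rightarrow> 'a set set set \<Rightarrow> 'a set set \<Rightarrow> 'a set set" where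
  "compatible_convex_hull K \<V> A =
     \<Inter>{B. B \<subseteq> K \<and> compatible \<V> B \<and> convex_in_complex K B \<and> A \<subseteq> B}"

definition atomic_coarsening :: "'a set set \<Rightarrow> 'a set set set \<Rightarrow> 'a set set set \<Rightarrow> bool" where
  "atomic_coarsening K \<V> \<V>' \<longleftrightarrow>
     multivector_field K \<V> \<and> multivector_field K \<V>' \<and>
     (\<forall>W\<in>\<V>. \<exists>W'\<in>\<V>'. W \<subseteq> W') \<and> card (\<V>' - \<V>) = 1 \<and> card (\<V> - \<V>') = 2"


section \<open>Dynamics\<close>

definition dyn :: "'a set set \<Rightarrow> 'a set set set \<Rightarrow> 'a set \<Rightarrow> 'a set set" where
  "dyn K \<V> \<sigma> = cl K {\<sigma>} \<union> multivector_of \<V> \<sigma>"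

definition path ::
    "'a set set \<Rightarrow> 'a set set set \<Rightarrow> 'a set set \<Rightarrow> nat \<Rightarrow> (nat \<Rightarrow> 'a set) \<Rightarrow> bool" where
  "path K \<V> A n \<rho> \<longleftrightarrow>
     A \<subseteq> K \<and> (\<forall>i\<le>n. \<rho> i \<in> A) \<and> (\<forall>i<n. \<rho> (Suc i) \<in> dyn K \<V> (\<rho> i))"

definition solution :: "'a set set \<Rightarrow> 'a set set set \<Rightarrow> (int \<Rightarrow> 'a set) \<Rightarrow> bool" where
  "solution K \<V> \<rho> \<longleftrightarrow> range \<rho> \<subseteq> K \<and> (\<forall>i. \<rho> (i + 1) \<in> dyn K \<V> (\<rho> i))"

definition essential_solution ::
    "'f::{field,finite} itself \<Rightarrow> 'a set set \<Rightarrow> 'a set set set \<Rightarrow> (int \<Rightarrow> 'a set) \<Rightarrow> bool" where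
  "essential_solution \<F> K \<V> \<rho> \<longleftrightarrow>
     solution K \<V> \<rho> \<and>
     (\<forall>i. \<not> critical \<F> K (multivector_of \<V> (\<rho> i)) \<longrightarrow>
        (\<exists>j k. j < i \<and> i < k \<and>
           multivector_of \<V> (\<rho> j) \<noteq> multivector_of \<V> (\<rho> i) \<and>
           multivector_of \<V> (\<rho> i) \<noteq> multivector_of \<V> (\<rho> k)))"

definition Inv ::
    "'f::{field,finite} itself \<Rightarrow> 'a set set \<Rightarrow> 'a set set set \<Rightarrow> 'a set set \<Rightarrow> 'a set set" where
  "Inv \<F> K \<V> A =
     {\<sigma> \<in> A. \<exists>\<rho>. essential_solution \<F> K \<V> \<rho> \<and> range \<rho> \<subseteq> A \<and> (\<exists>i. \<rho> i = \<sigma>)}"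

definition invariant_set ::
    "'f::{field,finite} itself \<Rightarrow> 'a set set \<Rightarrow> 'a set set set \<Rightarrow> 'a set set \<Rightarrow> bool" where
  "invariant_set \<F> K \<V> S \<longleftrightarrow> S = Inv \<F> K \<V> S"

definition isolating_set ::
    "'a set set \<Rightarrow> 'a set set set \<Rightarrow> 'a set set \<Rightarrow> 'a set set \<Rightarrow> bool" where
  "isolating_set K \<V> S N \<longleftrightarrow>
     closed_in_complex K N \<and> (\<Union>\<sigma>\<in>S. dyn K \<V> \<sigma>) \<subseteq> N \<and>
     (\<forall>n \<rho>. path K \<V> N n \<rho> \<and> \<rho> 0 \<in> S \<and> \<rho> n \<in> S \<longrightarrow> (\<forall>i\<le>n. \<rho> i \<in> S))"

definition isolated_invariant_set ::
    "'f::{field,finite} itself \<Rightarrow> 'a set set \<Rightarrow> 'a set set set \<Rightarrow> 'a set set \<Rightarrow> bool" where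
  "isolated_invariant_set \<F> K \<V> S \<longleftrightarrow>
     invariant_set \<F> K \<V> S \<and> (\<exists>N. isolating_set K \<V> S N)"

end

(* An isolated invariant set S'' is convex and compatible: a simplex between two of its members,
   or in a multivector that it meets, lies on a path of length two with both ends in S''.
   As S'' meets V, it therefore contains the compatible convex hull A of S and V, and Inv is
   monotone. *)

theory Submission
  imports Defs
begin

lemma Inv_mono: "A \<subseteq> B \<Longrightarrow> Inv \<F> K \<V> A \<subseteq> Inv \<F> K \<V> B"
  unfolding Inv_def by blast

lemma multivector_of_eq:
  assumes "multivector_field K \<V>" "V \<in> \<V>" "\<sigma> \<in> V"
  shows "multivector_of \<V> \<sigma> = V"
  unfolding multivector_of_def
proof (rule the_equality)
  have "disjoint \<V>"
    using assms(1) unfolding multivector_field_def partition_on_def by blast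
  then show "W = V" if "W \<in> \<V> \<and> \<sigma> \<in> W" for W
    using disjointD[of \<V> W V] assms(2,3) that by blast
qed (use assms in simp)

text \<open>The set \<open>A\<close> is arbitrary; the bound comes from solutions taking values in
  \<open>K\<close>. It is how an invariant set is seen to lie in the complex.\<close>

lemma Inv_subset_complex: "Inv \<F> K \<V> A \<subseteq> K"
  unfolding Inv_def essential_solution_def solution_def by blast

text \<open>Isolation applied to the path \<sigma>, \<rho>, \<tau>. Convexity and compatibility both
  reduce to this: it suffices to reach \<rho> from one member of \<open>S\<close> and to return to
  \<open>S\<close> in one step.\<close>

lemma isolating_set_two_step:
  assumes "isolating_set K \<V> S N" "S \<subseteq> K" "\<sigma> \<in> S" "\<tau> \<in> S"
    and step: "\<rho> \<in> dyn K \<V> \<sigma>" "\<tau> \<in> dyn K \<V> \<rho>"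
  shows "\<rho> \<in> S"
proof -
  \<comment> \<open>Only the indices 0, 1, 2 matter; the constant tail merely makes \<open>p\<close>
    total.\<close>
  define p where "p = (\<lambda>i::nat. if i = 0 then \<sigma> else if i = 1 then \<rho> else \<tau>)"
  have p: "p 0 = \<sigma>" "p 1 = \<rho>" "p 2 = \<tau>" by (simp_all add: p_def)
  have dynN: "dyn K \<V> \<alpha> \<subseteq> N" if "\<alpha> \<in> S" for \<alpha>
    using assms(1) that unfolding isolating_set_def by blast
  \<comment> \<open>Isolation concerns only paths inside \<open>N\<close>. The ends lie there
    because a simplex is its own face, hence in its own image under \<open>dyn\<close>; the middle
    \<rho> lies in the image of \<sigma>.\<close>
  have "\<alpha> \<in> N" if "\<alpha> \<in> S" for \<alpha>
  proof -
    have "\<alpha> \<in> dyn K \<V> \<alpha>" using assms(2) that unfolding dyn_def cl_def by blast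
    then show ?thesis using dynN[OF that] by blast
  qed
  then have "\<sigma> \<in> N" "\<rho> \<in> N" "\<tau> \<in> N" using assms(3,4) step(1) dynN by blast+
  then have "\<forall>i\<le>2. p i \<in> N" by (simp add: p_def)
  moreover have "p (Suc i) \<in> dyn K \<V> (p i)" if "i < 2" for i
  proof -
    from that consider "i = 0" | "i = 1" by linarith
    then show ?thesis by cases (use step in \<open>simp_all add: p_def\<close>)
  qed
  moreover have "N \<subseteq> K"
    using assms(1) unfolding isolating_set_def closed_in_complex_def by blast
  ultimately have "path K \<V> N 2 p" unfolding path_def by blast
  moreover have "p 0 \<in> S" "p 2 \<in> S" using p assms(3,4) by simp_all
  ultimately have "\<forall>i\<le>2. p i \<in> S"
    using assms(1) unfolding isolating_set_def by blast
  then have "p 1 \<in> S" by simp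
  then show ?thesis by (simp add: p_def)
qed

lemma isolating_set_convex:
  assumes "isolating_set K \<V> S N" "S \<subseteq> K"
  shows "convex_in_complex K S"
  unfolding convex_in_complex_def
proof (intro conjI ballI impI)
  fix \<sigma> \<tau> \<rho> assume "\<sigma> \<in> S" "\<tau> \<in> S" "\<rho> \<in> K" "\<sigma> \<subseteq> \<rho> \<and> \<rho> \<subseteq> \<tau>"
  \<comment> \<open>The dynamics passes from a simplex down to its faces, so the path runs from
    \<tau> through \<rho> to \<sigma>.\<close>
  moreover from this have "\<rho> \<in> dyn K \<V> \<tau>" "\<sigma> \<in> dyn K \<V> \<rho>"
    using assms(2) unfolding dyn_def cl_def by blast+
  ultimately show "\<rho> \<in> S" using isolating_set_two_step[OF assms, of \<tau> \<sigma> \<rho>] by simp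
qed (rule assms(2))

text \<open>Inside a multivector the dynamics moves freely in both directions, so from a common
  simplex \<sigma> one can step to any \<rho> in \<open>V\<close> and back to \<sigma>.\<close>

lemma isolating_set_multivector_subset:
  assumes "multivector_field K \<V>" "isolating_set K \<V> S N" "S \<subseteq> K"
    and V: "V \<in> \<V>" "V \<inter> S \<noteq> {}"
  shows "V \<subseteq> S"
proof
  fix \<rho> assume \<rho>: "\<rho> \<in> V"
  obtain \<sigma> where \<sigma>: "\<sigma> \<in> V" "\<sigma> \<in> S" using V(2) by blast
  then have "\<rho> \<in> dyn K \<V> \<sigma>" "\<sigma> \<in> dyn K \<V> \<rho>"
    using \<rho> by (simp_all add: dyn_def multivector_of_eq[OF assms(1) V(1)])
  then show "\<rho> \<in> S" by (rule isolating_set_two_step[OF assms(2,3) \<sigma>(2) \<sigma>(2)])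
qed

lemma isolating_set_compatible:
  assumes "multivector_field K \<V>" "isolating_set K \<V> S N" "S \<subseteq> K"
  shows "compatible \<V> S"
  unfolding compatible_def
\<comment> \<open>The multivectors meeting \<open>S\<close> cover it, as the field partitions
  \<open>K\<close>, and each lies inside \<open>S\<close> by the previous lemma.\<close>
proof (rule exI[of _ "{V \<in> \<V>. V \<inter> S \<noteq> {}}"], rule conjI)
  have "\<Union>\<V> = K"
    using assms(1) by (simp add: multivector_field_def partition_on_def)
  then show "S = \<Union> {V \<in> \<V>. V \<inter> S \<noteq> {}}"
    using isolating_set_multivector_subset[OF assms] assms(3) by blast
qed blast

theorem proposition28:
  fixes \<F> :: "'f::{field,finite} itself"
    and K :: "'a set set"
    and \<V> \<V>' :: "'a set set set"
    and S S' S'' A V :: "'a set set"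
  assumes "finite_simplicial_complex K"
    and "multivector_field K \<V>"
    and "isolated_invariant_set \<F> K \<V> S" and "S \<noteq> {}"
    and "isolated_invariant_set \<F> K \<V>' S'"
    and "atomic_coarsening K \<V> \<V>'"
    and "V \<in> \<V>' - \<V>"
    and "V \<inter> S \<noteq> {}" and "\<not> V \<subseteq> S"
    and "A = compatible_convex_hull K \<V>' (S \<union> V)"
    and "Inv \<F> K \<V> A \<noteq> S"
    and "S' = Inv \<F> K \<V>' A"
    and "\<exists>N. isolating_set K \<V> S N \<and> isolating_set K \<V>' S' N"
    and "isolated_invariant_set \<F> K \<V>' S''"
    and "S \<subseteq> S''"
  shows "S' \<subseteq> S''"
proof -
  have field': "multivector_field K \<V>'"
    using assms(6) by (simp add: atomic_coarsening_def)
  have inv: "S'' = Inv \<F> K \<V>' S''" and sub: "S'' \<subseteq> K"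
    using assms(14) Inv_subset_complex[of \<F> K \<V>' S'']
    by (simp_all add: isolated_invariant_set_def invariant_set_def)
  obtain N where N: "isolating_set K \<V>' S'' N"
    using assms(14) by (auto simp: isolated_invariant_set_def)
  have "V \<subseteq> S''"
    using isolating_set_multivector_subset[OF field' N sub] assms(7,8,15) by blast
  \<comment> \<open>\<open>S''\<close> is itself one of the sets whose intersection defines the hull
    \<open>A\<close>.\<close>
  then have "A \<subseteq> S''"
    using sub isolating_set_convex[OF N sub] isolating_set_compatible[OF field' N sub] assms(15)
    unfolding assms(10) compatible_convex_hull_def by blast
  \<comment> \<open>Invariance rewrites the right-hand \<open>S''\<close> as its own invariant part,
    so that both sides are values of \<open>Inv\<close> under the same field.\<close>
  then show ?thesis
    unfolding assms(12) by (subst inv) (rule Inv_mono)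
qed

end
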